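(* Let $m^2\in\mathbb R$, $\lambda_\Phi>0$ and $\mathbf J\in\mathbb R^3$, $\mathbf J\neq0$. For $\boldsymbol\rho\in\mathbb R^3$ with $r=\|\boldsymbol\rho\|$ let $$V_{\rm cap}(\boldsymbol\rho)=-\frac{m^2}{2}r^2+\frac{\lambda_\Phi}{4}r^4-\mathbf J\cdot\boldsymbol\rho .$$ Then every global minimum of $V_{\rm cap}$ is of the form $\boldsymbol\rho=t\,\widehat{\mathbf J}$, $\widehat{\mathbf J}=\mathbf J/\|\mathbf J\|$, where $t>0$ satisfies $$\lambda_\Phi t^3-m^2t-\|\mathbf J\|=0 .$$ At such a point the two Hessian eigenvalues transverse to $\mathbf J$ both equal $\|\mathbf J\|/t>0$ and the radial Hessian eigenvalue equals $2\lambda_\Phi t^2+\|\mathbf J\|/t>0$; so the minimum is isolated and stable and $\boldsymbol\rho$ is parallel to $\mathbf J$.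
   Context: In the application $\mathbb R^3$ is a three-edge subspace $W$ of the $\mathbf{27}$ of $E_6$ and $\mathbf J=\eta P_WH_q^\#$, where $\eta$ is a real coupling, $P_W$ the projection onto $W$, and $H_q^\#$ the Jordan adjoint of a fixed element $H_q$ of the Albert algebra; the statement uses only that $\mathbf J$ is a fixed nonzero vector in $W\cong\mathbb R^3$. *)

theory Defs
  imports "HOL-Analysis.Analysis"
begin

definition V_cap :: "real \<Rightarrow> real \<Rightarrow> real ^ 3 \<Rightarrow> real ^ 3 \<Rightarrow> real" where
  "V_cap m2 lam J \<rho> = - (m2 / 2) * norm \<rho> ^ 2 + lam / 4 * norm \<rho> ^ 4 - J \<bullet> \<rho>"

definition global_min_at :: "('a \<Rightarrow> real) \<Rightarrow> 'a \<Rightarrow> bool" where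
  "global_min_at f x \<longleftrightarrow> (\<forall>y. f x \<le> f y)"

definition local_min_at :: "('a::topological_space \<Rightarrow> real) \<Rightarrow> 'a \<Rightarrow> bool" where
  "local_min_at f x \<longleftrightarrow> (\<forall>\<^sub>F y in nhds x. f x \<le> f y)"

definition isolated_min_at :: "('a::topological_space \<Rightarrow> real) \<Rightarrow> 'a \<Rightarrow> bool" where
  "isolated_min_at f x \<longleftrightarrow> (\<forall>\<^sub>F y in at x. f x < f y \<and> \<not> local_min_at f y)"

text \<open>
  The Hessian is the Jacobian matrix of the gradient field. The relational form asserts that
  the gradient exists near the point and is differentiable at it.
\<close>

definition has_hessian ::
  "(real ^ 'n::finite \<Rightarrow> real) \<Rightarrow> real ^ 'n ^ 'n \<Rightarrow> real ^ 'n \<Rightarrow> bool" where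
  "has_hessian f H x \<longleftrightarrow>
     (\<exists>g. (\<forall>\<^sub>F y in nhds x. GDERIV f y :> g y) \<and> (g has_derivative (\<lambda>h. H *v h)) (at x))"

lemma has_hessian_unique:
  assumes "has_hessian f H x" "has_hessian f K x"
  shows "H = K"
proof -
  obtain g where g: "\<forall>\<^sub>F y in nhds x. GDERIV f y :> g y" "(g has_derivative (\<lambda>h. H *v h)) (at x)"
    using assms(1) by (auto simp: has_hessian_def)
  obtain k where k: "\<forall>\<^sub>F y in nhds x. GDERIV f y :> k y" "(k has_derivative (\<lambda>h. K *v h)) (at x)"
    using assms(2) by (auto simp: has_hessian_def)
  have uniq: "u = v" if "GDERIV f y :> u" "GDERIV f y :> v" for u v y
  proof -
    have "(\<lambda>h. h \<bullet> u) = (\<lambda>h. h \<bullet> v)"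
      using that unfolding gderiv_def by (rule has_derivative_unique)
    then have "\<forall>h. h \<bullet> u = h \<bullet> v"
      by (simp add: fun_eq_iff)
    then show "u = v"
      by (simp only: vector_eq_ldot)
  qed
  have eq: "\<forall>\<^sub>F y in nhds x. g y = k y"
    using g(1) k(1) by eventually_elim (rule uniq)
  have "(k has_derivative (\<lambda>h. H *v h)) (at x)"
  proof (rule has_derivative_transform_eventually[OF g(2)])
    show "\<forall>\<^sub>F y in at x. g y = k y"
      using eq unfolding eventually_at_filter by eventually_elim blast
    show "g x = k x"
      using eq by (rule eventually_nhds_x_imp_x)
  qed simp
  then have "(\<lambda>h. H *v h) = (\<lambda>h. K *v h)"
    using k(2) by (rule has_derivative_unique)
  then show "H = K"
    by (simp add: matrix_eq fun_eq_iff)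
qed

definition eigenvector_of :: "real ^ 'n ^ 'n \<Rightarrow> real ^ 'n \<Rightarrow> real \<Rightarrow> bool" where
  "eigenvector_of A v \<mu> \<longleftrightarrow> v \<noteq> 0 \<and> A *v v = \<mu> *\<^sub>R v"

text \<open>
  Stability in the sense of a vacuum: a critical point at which all Hessian eigenvalues
  (squared masses) are positive.
\<close>

definition stable_at :: "(real ^ 'n::finite \<Rightarrow> real) \<Rightarrow> real ^ 'n \<Rightarrow> bool" where
  "stable_at f x \<longleftrightarrow>
     (GDERIV f x :> 0) \<and>
     (\<exists>H. has_hessian f H x \<and> (\<forall>v \<mu>. eigenvector_of H v \<mu> \<longrightarrow> 0 < \<mu>))"

end

(*
  Every critical point y satisfies (lam |y|^2 - m2) y = J, and comparing with -y shows that the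
  scalar factor is positive at a global minimum.  Conversely, a positive root t of the cubic allows
  one to eliminate m2, and with \<rho> = t J / |J| one gets
    V(y) - V(\<rho>) = lam/4 (|y|^2 - t^2)^2 + |J|/(2t) |y - \<rho>|^2,
  so \<rho> is the strict global minimum.  The gradient at y, paired with y - \<rho>, is
    lam/2 (|y|^2 - t^2)^2 + (lam/2 (|y|^2 - t^2) + |J|/t) |y - \<rho>|^2,
  which is positive for y near \<rho>, so no other critical point is nearby.
*)

theory Submission
  imports Defs
begin

lemma GDERIV_V_cap: "GDERIV (V_cap m2 lam J) y :> (lam * (y \<bullet> y) - m2) *\<^sub>R y - J"
proof -
  \<comment> \<open>Expressed through \<open>z \<bullet> z\<close> the potential is a polynomial, so
    the derivative rules cover the origin too, where \<open>norm\<close> is not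
    differentiable.\<close>
  have "norm z ^ 4 = (z \<bullet> z)\<^sup>2" for z :: "real ^ 3"
    by (metis mult_2 numeral_Bit0 power2_norm_eq_inner power_mult)
  then have eq: "V_cap m2 lam J = (\<lambda>y. - (m2 / 2) * (y \<bullet> y) + lam / 4 * (y \<bullet> y)\<^sup>2 - J \<bullet> y)"
    by (simp add: fun_eq_iff V_cap_def power2_norm_eq_inner)
  show ?thesis
    unfolding eq gderiv_def
    by (auto intro!: derivative_eq_intros
        simp: fun_eq_iff inner_diff_right inner_commute algebra_simps power2_eq_square)
qed

lemma local_min_at_GDERIV_0:
  fixes f :: "'a::real_inner \<Rightarrow> real"
  assumes "local_min_at f x" "GDERIV f x :> D"
  shows "D = 0"
proof -
  have "(\<lambda>h. h \<bullet> D) = (\<lambda>h. 0)"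
  proof (rule has_derivative_local_min)
    show "(f has_derivative (\<lambda>h. h \<bullet> D)) (at x)"
      using assms(2) by (simp add: gderiv_def)
    show "\<forall>\<^sub>F y in at x. f x \<le> f y"
      using assms(1) unfolding local_min_at_def eventually_at_filter
      by (rule eventually_mono) simp
  qed
  then have "D \<bullet> D = 0" by metis
  then show ?thesis by simp
qed

lemma global_min_at_imp_local_min_at: "global_min_at f x \<Longrightarrow> local_min_at f x"
  by (simp add: global_min_at_def local_min_at_def)

lemma global_min_V_cap:
  assumes "J \<noteq> 0" and min: "global_min_at (V_cap m2 lam J) \<rho>"
  shows "\<exists>t>0. \<rho> = t *\<^sub>R (J /\<^sub>R norm J) \<and> lam * t ^ 3 - m2 * t - norm J = 0"
proof -
  define k where "k = lam * (\<rho> \<bullet> \<rho>) - m2"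
  have J: "J = k *\<^sub>R \<rho>"
    using local_min_at_GDERIV_0[OF global_min_at_imp_local_min_at[OF min] GDERIV_V_cap]
    by (simp add: k_def)
  then have nz: "k \<noteq> 0" "\<rho> \<noteq> 0" using \<open>J \<noteq> 0\<close> by auto
  \<comment> \<open>The quadratic and quartic terms agree at \<open>\<rho>\<close> and
    \<open>- \<rho>\<close>, so only the sign of the linear term
    \<open>J \<bullet> \<rho> = k * (\<rho> \<bullet> \<rho>)\<close> is at stake.\<close>
  have "V_cap m2 lam J \<rho> \<le> V_cap m2 lam J (- \<rho>)"
    using min by (simp add: global_min_at_def)
  then have "0 \<le> k * (\<rho> \<bullet> \<rho>)"
    by (simp add: V_cap_def J)
  then have "k > 0"
    using nz by (metis inner_gt_zero_iff linorder_neqE_linordered_idom mult_neg_pos not_less)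
  then have nJ: "norm J = k * norm \<rho>" by (simp add: J)
  show ?thesis
  proof (intro exI conjI)
    show "norm \<rho> > 0" using nz by simp
    show "\<rho> = norm \<rho> *\<^sub>R (J /\<^sub>R norm J)"
      using nz \<open>k > 0\<close> unfolding nJ by (simp add: J field_simps)
    \<comment> \<open>With \<open>t = norm \<rho>\<close> the cubic is
      \<open>norm J = k * norm \<rho>\<close> multiplied out.\<close>
    show "lam * norm \<rho> ^ 3 - m2 * norm \<rho> - norm J = 0"
      unfolding nJ k_def
      by (simp add: power3_eq_cube algebra_simps flip: power2_norm_eq_inner)
        (simp add: power2_eq_square)
  qed
qed

text \<open>The product rule applied to the gradient: differentiating the factor
  \<open>y \<bullet> y\<close> yields the rank-one term along \<open>x\<close>.\<close>

lemma has_hessian_V_cap: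
  "has_hessian (V_cap m2 lam J)
     (matrix (\<lambda>h. (lam * (x \<bullet> x) - m2) *\<^sub>R h + (2 * lam * (x \<bullet> h)) *\<^sub>R x)) x"
proof -
  let ?L = "\<lambda>h. (lam * (x \<bullet> x) - m2) *\<^sub>R h + (2 * lam * (x \<bullet> h)) *\<^sub>R x"
  have D: "((\<lambda>y. (lam * (y \<bullet> y) - m2) *\<^sub>R y - J) has_derivative ?L) (at x)"
    by (auto intro!: derivative_eq_intros simp: fun_eq_iff inner_commute algebra_simps)
  then have "(\<lambda>h. matrix ?L *v h) = ?L"
    by (intro matrix_vector_mul(2) has_derivative_linear)
  then show ?thesis
    unfolding has_hessian_def using D GDERIV_V_cap by (metis (no_types, lifting) always_eventually)
qed

text \<open>The converse direction: only a positive root of the cubic is given, and minimality of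
  \<open>\<rho>\<close> is derived from it.\<close>

locale V_cap_critical =
  fixes m2 lam t :: real and J \<rho> :: "real ^ 3"
  assumes lam: "lam > 0" and J: "J \<noteq> 0" and t: "t > 0"
    and cubic: "lam * t ^ 3 - m2 * t - norm J = 0"
    and \<rho>: "\<rho> = t *\<^sub>R (J /\<^sub>R norm J)"
begin

lemma norm_\<rho>: "\<rho> \<bullet> \<rho> = t\<^sup>2"
  using J t by (simp add: \<rho> flip: power2_norm_eq_inner)

text \<open>The vanishing of the gradient in explicit form; the multiplier \<open>norm J / t\<close>
  reappears as the transverse Hessian eigenvalue.\<close>

lemma J_eq: "J = (norm J / t) *\<^sub>R \<rho>"
  using J t by (simp add: \<rho>)

lemma m2_eq: "m2 = lam * t\<^sup>2 - norm J / t"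
proof -
  have "m2 * t = (lam * t\<^sup>2 - norm J / t) * t"
    using cubic t by (simp add: left_diff_distrib power2_eq_square power3_eq_cube)
  then show ?thesis using t by simp
qed

lemma V_cap_diff:
  "V_cap m2 lam J y - V_cap m2 lam J \<rho> =
     lam / 4 * (y \<bullet> y - t\<^sup>2)\<^sup>2 + norm J / (2 * t) * ((y - \<rho>) \<bullet> (y - \<rho>))"
proof -
  \<comment> \<open>Once \<open>q\<close> replaces the quotient, the claim is a polynomial identity
    in \<open>lam\<close>, \<open>t\<close>, \<open>q\<close>, \<open>y \<bullet> y\<close> and
    \<open>\<rho> \<bullet> y\<close>.\<close>
  define q where "q = norm J / t"
  have V: "V_cap m2 lam J z =
      - ((lam * t\<^sup>2 - q) / 2) * (z \<bullet> z) + lam / 4 * (z \<bullet> z)\<^sup>2 - q * (\<rho> \<bullet> z)" for z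
  proof -
    have "J \<bullet> z = q * (\<rho> \<bullet> z)" by (subst J_eq) (simp add: q_def)
    moreover have "norm z ^ 4 = (z \<bullet> z)\<^sup>2"
      by (metis mult_2 numeral_Bit0 power2_norm_eq_inner power_mult)
    ultimately show ?thesis
      by (simp add: V_cap_def power2_norm_eq_inner m2_eq q_def)
  qed
  have half: "norm J / (2 * t) = q / 2" by (simp add: q_def)
  show ?thesis
    unfolding V half inner_diff_left inner_diff_right norm_\<rho> inner_commute[of y \<rho>]
    by (simp add: field_simps power2_eq_square)
qed

lemma strict_min:
  assumes "y \<noteq> \<rho>"
  shows "V_cap m2 lam J \<rho> < V_cap m2 lam J y"
proof -
  have "0 < norm J / (2 * t) * ((y - \<rho>) \<bullet> (y - \<rho>))" using assms J t by simp
  moreover have "0 \<le> lam / 4 * (y \<bullet> y - t\<^sup>2)\<^sup>2" using lam by simp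
  ultimately show ?thesis using V_cap_diff[of y] by linarith
qed

text \<open>Serves to exclude other critical points near \<open>\<rho>\<close>: at one of them the
  left side is zero, which is impossible for \<open>y \<noteq> \<rho>\<close> as long as the
  coefficient of the last term is positive.\<close>

lemma gradient_inner:
  "((lam * (y \<bullet> y) - m2) *\<^sub>R y - J) \<bullet> (y - \<rho>) =
     lam / 2 * (y \<bullet> y - t\<^sup>2)\<^sup>2 + (lam / 2 * (y \<bullet> y - t\<^sup>2) + norm J / t) * ((y - \<rho>) \<bullet> (y - \<rho>))"
proof -
  define q where "q = norm J / t"
  have "J \<bullet> z = q * (\<rho> \<bullet> z)" for z by (subst J_eq) (simp add: q_def)
  then show ?thesis
    unfolding m2_eq q_def[symmetric] inner_diff_left inner_diff_right inner_scaleR_left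
      norm_\<rho> inner_commute[of y \<rho>]
    by (simp add: norm_\<rho> field_simps power2_eq_square)
qed

lemma isolated_min: "isolated_min_at (V_cap m2 lam J) \<rho>"
proof -
  \<comment> \<open>This coefficient from \<open>gradient_inner\<close> equals
    \<open>norm J / t\<close> at \<open>\<rho>\<close>, so by continuity it stays positive
    nearby.\<close>
  let ?c = "\<lambda>y::real^3. lam / 2 * (y \<bullet> y - t\<^sup>2) + norm J / t"
  have "(?c \<longlongrightarrow> ?c \<rho>) (at \<rho>)" by (intro tendsto_intros)
  moreover have "?c \<rho> > 0" using J t by (simp add: norm_\<rho>)
  ultimately have "\<forall>\<^sub>F y in at \<rho>. 0 < ?c y" by (rule order_tendstoD)
  moreover have "\<forall>\<^sub>F y in at \<rho>. y \<noteq> \<rho>" by (simp add: eventually_at_filter)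
  ultimately show ?thesis unfolding isolated_min_at_def
  proof eventually_elim
    case (elim y)
    have "\<not> local_min_at (V_cap m2 lam J) y"
    proof
      assume "local_min_at (V_cap m2 lam J) y"
      then have "(lam * (y \<bullet> y) - m2) *\<^sub>R y - J = 0"
        using GDERIV_V_cap by (rule local_min_at_GDERIV_0)
      then have "lam / 2 * (y \<bullet> y - t\<^sup>2)\<^sup>2 + ?c y * ((y - \<rho>) \<bullet> (y - \<rho>)) = 0"
        using gradient_inner[of y] by simp
      moreover have "0 < ?c y * ((y - \<rho>) \<bullet> (y - \<rho>))"
        using elim by (intro mult_pos_pos) auto
      moreover have "0 \<le> lam / 2 * (y \<bullet> y - t\<^sup>2)\<^sup>2" using lam by simp
      ultimately show False by linarith
    qed
    then show ?case using strict_min elim by blast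
  qed
qed

text \<open>At \<open>\<rho>\<close> the scalar factor of the gradient is \<open>norm J / t\<close>,
  so the Hessian is a positive multiple of the identity plus a rank-one term along
  \<open>\<rho>\<close>.\<close>

lemma hessian:
  obtains H where "has_hessian (V_cap m2 lam J) H \<rho>"
    and "\<And>v. H *v v = (norm J / t) *\<^sub>R v + (2 * lam * (\<rho> \<bullet> v)) *\<^sub>R \<rho>"
proof -
  let ?L = "\<lambda>h. (lam * (\<rho> \<bullet> \<rho>) - m2) *\<^sub>R h + (2 * lam * (\<rho> \<bullet> h)) *\<^sub>R \<rho>"
  have "linear ?L" by (rule linearI) (simp_all add: algebra_simps inner_add_right)
  then have "(\<lambda>v. matrix ?L *v v) = ?L" by (rule matrix_vector_mul(2))
  then have "matrix ?L *v v = ?L v" for v by metis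
  moreover have "lam * (\<rho> \<bullet> \<rho>) - m2 = norm J / t" by (simp add: norm_\<rho> m2_eq)
  ultimately show thesis using that[OF has_hessian_V_cap] by simp
qed

lemma stable: "stable_at (V_cap m2 lam J) \<rho>"
proof -
  have "local_min_at (V_cap m2 lam J) \<rho>"
    using strict_min
    by (intro global_min_at_imp_local_min_at) (metis global_min_at_def less_imp_le order_refl)
  then have "GDERIV (V_cap m2 lam J) \<rho> :> 0"
    using GDERIV_V_cap local_min_at_GDERIV_0 by metis
  moreover obtain H where H: "has_hessian (V_cap m2 lam J) H \<rho>"
    "\<And>v. H *v v = (norm J / t) *\<^sub>R v + (2 * lam * (\<rho> \<bullet> v)) *\<^sub>R \<rho>"
    by (rule hessian) blast
  moreover have "0 < \<mu>" if "eigenvector_of H v \<mu>" for v \<mu>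
  proof -
    have v: "v \<noteq> 0" "(norm J / t) *\<^sub>R v + (2 * lam * (\<rho> \<bullet> v)) *\<^sub>R \<rho> = \<mu> *\<^sub>R v"
      using that H(2) by (auto simp: eigenvector_of_def)
    \<comment> \<open>Pairing the eigenvalue equation with \<open>v\<close> turns the rank-one term
      into a nonnegative square.\<close>
    have "\<mu> * (v \<bullet> v) = norm J / t * (v \<bullet> v) + 2 * lam * (\<rho> \<bullet> v)\<^sup>2"
      using arg_cong[OF v(2), of "\<lambda>w. w \<bullet> v"]
      by (simp add: inner_add_left power2_eq_square)
    moreover have "0 < norm J / t * (v \<bullet> v)" using v J t by simp
    moreover have "0 \<le> 2 * lam * (\<rho> \<bullet> v)\<^sup>2" using lam by simp
    ultimately have "0 < \<mu> * (v \<bullet> v)" by linarith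
    then show ?thesis by (rule zero_less_mult_pos2) (simp add: v(1))
  qed
  ultimately show ?thesis unfolding stable_at_def by blast
qed

text \<open>Since \<open>\<rho>\<close> is a multiple of \<open>J\<close>, the rank-one term
  vanishes on vectors orthogonal to \<open>J\<close>; on \<open>J\<close> itself it acts as the
  scalar \<open>2 * lam * t ^ 2\<close> because \<open>\<rho> \<bullet> \<rho>\<close> is the square
  of \<open>t\<close>.\<close>

lemma hessian_eigenvectors:
  "\<exists>H. has_hessian (V_cap m2 lam J) H \<rho> \<and>
       (\<forall>v. v \<noteq> 0 \<and> J \<bullet> v = 0 \<longrightarrow> eigenvector_of H v (norm J / t)) \<and>
       eigenvector_of H J (2 * lam * t ^ 2 + norm J / t)"
proof -
  obtain H where H: "has_hessian (V_cap m2 lam J) H \<rho>"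
    "\<And>v. H *v v = (norm J / t) *\<^sub>R v + (2 * lam * (\<rho> \<bullet> v)) *\<^sub>R \<rho>"
    by (rule hessian) blast
  have "(\<rho> \<bullet> J) *\<^sub>R \<rho> = t\<^sup>2 *\<^sub>R J"
  proof -
    have "(\<rho> \<bullet> J) *\<^sub>R \<rho> = (\<rho> \<bullet> ((norm J / t) *\<^sub>R \<rho>)) *\<^sub>R \<rho>" using J_eq by metis
    also have "\<dots> = t\<^sup>2 *\<^sub>R ((norm J / t) *\<^sub>R \<rho>)" by (simp add: norm_\<rho> mult.commute)
    also have "\<dots> = t\<^sup>2 *\<^sub>R J" using J_eq by metis
    finally show ?thesis .
  qed
  then have "(2 * lam * (\<rho> \<bullet> J)) *\<^sub>R \<rho> = (2 * lam * t\<^sup>2) *\<^sub>R J"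
    by (metis scaleR_scaleR)
  then have "H *v J = (2 * lam * t\<^sup>2 + norm J / t) *\<^sub>R J"
    using H(2)[of J] by (simp add: scaleR_add_left)
  moreover have "H *v v = (norm J / t) *\<^sub>R v" if "J \<bullet> v = 0" for v
    using that H(2)[of v] by (simp add: \<rho>)
  ultimately show ?thesis
    using H(1) J unfolding eigenvector_of_def by blast
qed

lemma parallel: "\<exists>c>0. \<rho> = c *\<^sub>R J"
  using J t by (intro exI[of _ "t / norm J"]) (simp add: \<rho> divide_inverse)

end

theorem mainTheorem12:
  fixes m2 lam :: real and J :: "real ^ 3"
  assumes "lam > 0" and "J \<noteq> 0"
  shows "(\<forall>\<rho>. global_min_at (V_cap m2 lam J) \<rho> \<longrightarrow>
            (\<exists>t>0. \<rho> = t *\<^sub>R (J /\<^sub>R norm J) \<and> lam * t ^ 3 - m2 * t - norm J = 0)) \<and>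
         (\<forall>\<rho> t. t > 0 \<and> lam * t ^ 3 - m2 * t - norm J = 0 \<and> \<rho> = t *\<^sub>R (J /\<^sub>R norm J) \<longrightarrow>
            (\<exists>H. has_hessian (V_cap m2 lam J) H \<rho> \<and>
                 dim {v. J \<bullet> v = 0} = 2 \<and>
                 (\<forall>v. v \<noteq> 0 \<and> J \<bullet> v = 0 \<longrightarrow> eigenvector_of H v (norm J / t)) \<and>
                 eigenvector_of H J (2 * lam * t ^ 2 + norm J / t)) \<and>
            norm J / t > 0 \<and>
            2 * lam * t ^ 2 + norm J / t > 0 \<and>
            isolated_min_at (V_cap m2 lam J) \<rho> \<and>
            stable_at (V_cap m2 lam J) \<rho> \<and>
            (\<exists>c>0. \<rho> = c *\<^sub>R J))"
proof (intro conjI allI impI)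
  fix \<rho>
  assume "global_min_at (V_cap m2 lam J) \<rho>"
  then show "\<exists>t>0. \<rho> = t *\<^sub>R (J /\<^sub>R norm J) \<and> lam * t ^ 3 - m2 * t - norm J = 0"
    using \<open>J \<noteq> 0\<close> by (intro global_min_V_cap)
next
  fix \<rho> t
  assume "t > 0 \<and> lam * t ^ 3 - m2 * t - norm J = 0 \<and> \<rho> = t *\<^sub>R (J /\<^sub>R norm J)"
  then interpret V_cap_critical m2 lam t J \<rho>
    using assms by (intro V_cap_critical.intro) blast+
  \<comment> \<open>The dimension accounts for both transverse eigenvalues: all nonzero vectors of
    this plane are eigenvectors for \<open>norm J / t\<close>.\<close>
  have "dim {v. J \<bullet> v = 0} = 2"
    using J by (simp add: dim_hyperplane)
  then show "\<exists>H. has_hessian (V_cap m2 lam J) H \<rho> \<and>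
                 dim {v. J \<bullet> v = 0} = 2 \<and>
                 (\<forall>v. v \<noteq> 0 \<and> J \<bullet> v = 0 \<longrightarrow> eigenvector_of H v (norm J / t)) \<and>
                 eigenvector_of H J (2 * lam * t ^ 2 + norm J / t)"
    using hessian_eigenvectors by blast
  show "norm J / t > 0" using J t by simp
  then show "2 * lam * t ^ 2 + norm J / t > 0" using lam by (simp add: add_nonneg_pos)
  show "isolated_min_at (V_cap m2 lam J) \<rho>" by (rule isolated_min)
  show "stable_at (V_cap m2 lam J) \<rho>" by (rule stable)
  show "\<exists>c>0. \<rho> = c *\<^sub>R J" by (rule parallel)
qed

end
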